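(* The integral congruence class of a unipotent companion is invariant under cyclic rearrangements of the vertices of a quiver. That is, let $Q$ be a quiver on $n$ vertices, let $\tau$ and $\tau'$ be two linear orderings of its vertices that differ by a cyclic shift, and let $U$ and $U'$ be the unipotent companions of $Q$ with respect to $\tau$ and $\tau'$. Then there exists $G\in\operatorname{GL}_n(\mathbb Z)$ such that $U'=GUG^T$.
   Context: A quiver is a finite directed graph without loops or oriented 2-cycles; multiple arrows are allowed. Given a linear ordering $v_1<\dots<v_n$ of the vertices, the exchange matrix $B=(b_{ij})$ of $Q$ is the skew-symmetric $n\times n$ integer matrix with $b_{ij}=x$ if $Q$ contains $x\ge0$ arrows $v_i\to v_j$ and $b_{ij}=-x$ if $Q$ contains $x\ge 0$ arrows $v_j\to v_i$. The unipotent companion of $Q$ (with respect to this linear ordering) is the unique unipotent upper-triangular matrix $U$ with $-B=U-U^T$; i.e., $U$ has $1$'s on the diagonal, entries $-b_{ij}$ for $i<j$, and $0$ for $i>j$. Two linear orderings differ by a cyclic shift if one is $v_1<\dots<v_n$ and the other is $v_{a+1}<\dots<v_n<v_1<\dots<v_a$ for some $a$. Two $n\times n$ integer matrices $L,M$ are (integrally) congruent if $M=GLG^T$ for some $G\in\operatorname{GL}_n(\mathbb Z)$. *)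

theory Defs
  imports "Graph_Theory.Digraph" "Jordan_Normal_Form.Matrix"
begin

locale quiver = fin_digraph Q + loopfree_digraph Q for Q :: "('a, 'b) pre_digraph" +
  assumes no_2_cycles: "(u, v) \<in> arcs_ends Q \<Longrightarrow> (v, u) \<notin> arcs_ends Q"

definition num_arrows :: "('a, 'b) pre_digraph \<Rightarrow> 'a \<Rightarrow> 'a \<Rightarrow> nat" where
  "num_arrows Q u v = card {e \<in> arcs Q. tail Q e = u \<and> head Q e = v}"

text \<open>A linear ordering \<open>v\<^sub>1 < \<dots> < v\<^sub>n\<close> of the vertices is the list \<open>[v\<^sub>1, \<dots>, v\<^sub>n]\<close>; list and
  matrix indices start at 0.\<close>

definition linear_ordering :: "('a, 'b) pre_digraph \<Rightarrow> 'a list \<Rightarrow> bool" where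
  "linear_ordering Q vs \<longleftrightarrow> distinct vs \<and> set vs = verts Q"

definition cyclic_shift :: "'a list \<Rightarrow> 'a list \<Rightarrow> bool" where
  "cyclic_shift vs vs' \<longleftrightarrow> (\<exists>a \<le> length vs. vs' = drop a vs @ take a vs)"

text \<open>The two clauses are compatible only because a quiver has no oriented 2-cycles (and no loops).\<close>

definition exchange_matrix :: "('a, 'b) pre_digraph \<Rightarrow> 'a list \<Rightarrow> int mat" where
  "exchange_matrix Q vs = mat (length vs) (length vs) (\<lambda>(i, j).
     if num_arrows Q (vs ! i) (vs ! j) > 0 then int (num_arrows Q (vs ! i) (vs ! j))
     else - int (num_arrows Q (vs ! j) (vs ! i)))"

definition unipotent_companion :: "('a, 'b) pre_digraph \<Rightarrow> 'a list \<Rightarrow> int mat" where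
  "unipotent_companion Q vs = mat (length vs) (length vs) (\<lambda>(i, j).
     if i = j then 1 else if i < j then - (exchange_matrix Q vs $$ (i, j)) else 0)"

definition GL_int :: "nat \<Rightarrow> int mat set" where
  "GL_int n = {G \<in> carrier_mat n n. invertible_mat G}"

context quiver
begin

lemma num_arrows_pos_iff: "num_arrows Q u v > 0 \<longleftrightarrow> (u, v) \<in> arcs_ends Q"
  by (auto simp: num_arrows_def card_gt_0_iff arcs_ends_conv)

lemma exchange_matrix_skew:
  assumes "i < length vs" "j < length vs"
  shows "exchange_matrix Q vs $$ (j, i) = - exchange_matrix Q vs $$ (i, j)"
  using assms no_2_cycles[of "vs ! i" "vs ! j"]
    num_arrows_pos_iff[of "vs ! i" "vs ! j"] num_arrows_pos_iff[of "vs ! j" "vs ! i"]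
  by (auto simp: exchange_matrix_def)

lemma unipotent_companion_unique:
  fixes U :: "int mat" and vs :: "'a list"
  defines "n \<equiv> length vs"
  shows "U = unipotent_companion Q vs \<longleftrightarrow>
    U \<in> carrier_mat n n \<and> upper_triangular U \<and> (\<forall>i<n. U $$ (i, i) = 1) \<and>
    - exchange_matrix Q vs = U - transpose_mat U" (is "?L \<longleftrightarrow> ?R")
proof
  assume U: ?L
  have "- exchange_matrix Q vs = U - transpose_mat U"
  proof (rule eq_matI)
    fix i j assume "i < dim_row (U - transpose_mat U)" "j < dim_col (U - transpose_mat U)"
    then have ij: "i < n" "j < n" by (auto simp: U unipotent_companion_def n_def)
    have d: "exchange_matrix Q vs \<in> carrier_mat n n" by (simp add: exchange_matrix_def n_def)
    show "(- exchange_matrix Q vs) $$ (i, j) = (U - transpose_mat U) $$ (i, j)"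
      using ij d exchange_matrix_skew[of i vs j]
      by (cases i j rule: linorder_cases)
        (auto simp: U unipotent_companion_def n_def)
  qed (auto simp: U unipotent_companion_def exchange_matrix_def)
  then show ?R by (auto simp: U unipotent_companion_def n_def upper_triangular_def)
next
  assume R: ?R
  show ?L
  proof (rule eq_matI)
    fix i j assume "i < dim_row (unipotent_companion Q vs)" "j < dim_col (unipotent_companion Q vs)"
    then have ij: "i < n" "j < n" by (auto simp: unipotent_companion_def n_def)
    have d: "exchange_matrix Q vs \<in> carrier_mat n n" by (simp add: exchange_matrix_def n_def)
    have "(- exchange_matrix Q vs) $$ (i, j) = (U - transpose_mat U) $$ (i, j)" using R by simp
    moreover have "U \<in> carrier_mat n n" using R by blast
    ultimately have "- (exchange_matrix Q vs $$ (i, j)) = U $$ (i, j) - U $$ (j, i)"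
      using ij d by simp
    then show "U $$ (i, j) = unipotent_companion Q vs $$ (i, j)"
      using ij R by (auto simp: unipotent_companion_def n_def upper_triangular_def)
  qed (use R in \<open>auto simp: unipotent_companion_def n_def\<close>)
qed

end

end

theory Submission
  imports Defs "Jordan_Normal_Form.Determinant"
begin

text \<open>For a shift by \<open>a\<close>, cut \<open>U\<close> into blocks, \<open>U = (A C; 0 D)\<close> with \<open>A\<close> of size \<open>a\<close>; skew-symmetry of
  the exchange matrix gives \<open>U' = (D -C\<^sup>T; 0 A)\<close>. The block \<open>A\<close> is unipotent, hence has an integral
  inverse \<open>B\<close>, and \<open>G = (-C\<^sup>T B\<^sup>T I; A B\<^sup>T 0)\<close> satisfies \<open>U' = G U G\<^sup>T\<close>.\<close>

lemma congruent_block_swap: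
  fixes A B C D :: "'a :: comm_ring_1 mat"
  assumes A: "A \<in> carrier_mat a a" and B: "B \<in> carrier_mat a a"
    and C: "C \<in> carrier_mat a b" and D: "D \<in> carrier_mat b b"
    and AB: "A * B = 1\<^sub>m a" and BA: "B * A = 1\<^sub>m a"
  obtains G where "G \<in> carrier_mat (a + b) (a + b)" "invertible_mat G"
    "four_block_mat D (- transpose_mat C) (0\<^sub>m a b) A
      = G * four_block_mat A C (0\<^sub>m b a) D * transpose_mat G"
proof
  define At Bt Ct where "At = transpose_mat A" and "Bt = transpose_mat B" and "Ct = transpose_mat C"
  have At: "At \<in> carrier_mat a a" and Bt: "Bt \<in> carrier_mat a a" and Ct: "Ct \<in> carrier_mat b a"
    using A B C by (auto simp: At_def Bt_def Ct_def)
  have BtAt: "Bt * At = 1\<^sub>m a" and AtBt: "At * Bt = 1\<^sub>m a"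
    by (simp_all add: At_def Bt_def AB BA flip: transpose_mult[OF A B] transpose_mult[OF B A])
  have cancel: "X * (Y * Z) = Z"
    if "X * Y = 1\<^sub>m a" "X \<in> carrier_mat a a" "Y \<in> carrier_mat a a" "Z \<in> carrier_mat a k"
    for X Y Z :: "'a mat" and k
    using that assoc_mult_mat[of X a a Y a Z k] by simp
  \<comment> \<open>\<open>W\<close> preserves the form of the first block:
    \<open>W * A * V = A\<close>, where \<open>V\<close> is the transpose of \<open>W\<close> and
    \<open>Z\<close> its inverse. \<open>Y\<close> is the solution of
    \<open>A * transpose_mat Y + C = 0\<close>, which is what makes the lower left block of the
    product vanish.\<close>
  define Y W V Z where "Y = - (Ct * Bt)" and "W = A * Bt" and "V = B * At" and "Z = At * B"
  have Y: "Y \<in> carrier_mat b a" and W: "W \<in> carrier_mat a a"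
    and V: "V \<in> carrier_mat a a" and Z: "Z \<in> carrier_mat a a"
    using A B At Bt Ct by (auto simp: Y_def W_def V_def Z_def)
  have Yt: "transpose_mat Y = - (B * C)"
    using transpose_mult[OF Ct Bt] B C by (simp add: Y_def Bt_def Ct_def transpose_uminus)
  have Wt: "transpose_mat W = V"
    using transpose_mult[OF A Bt] B by (simp add: W_def V_def At_def Bt_def)
  have WZ: "W * Z = 1\<^sub>m a"
    using assoc_mult_mat[OF A Bt Z] cancel[OF BtAt Bt At B] AB by (simp add: W_def Z_def)
  have ZW: "Z * W = 1\<^sub>m a"
    using assoc_mult_mat[OF At B W] cancel[OF BA B A Bt] AtBt by (simp add: W_def Z_def)
  define G where "G = four_block_mat Y (1\<^sub>m b) W (0\<^sub>m a b)"
  \<comment> \<open>The inverse of \<open>G\<close>, solved blockwise from that of \<open>W\<close>.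
    The rows of \<open>G\<close> split as b + a and its columns as a + b, those of \<open>H\<close>
    the other way round; so \<open>G * H\<close> comes in blocks b + a and \<open>H * G\<close> in
    blocks a + b.\<close>
  define H where "H = four_block_mat (0\<^sub>m a b) Z (1\<^sub>m b) (- (Y * Z))"
  show G: "G \<in> carrier_mat (a + b) (a + b)"
    using four_block_carrier_mat[OF Y, of "0\<^sub>m a b" a b] by (simp add: G_def add.commute)
  have H: "H \<in> carrier_mat (a + b) (a + b)"
    using four_block_carrier_mat[of "0\<^sub>m a b" a b "- (Y * Z)" b a] Y Z
    by (simp add: H_def add.commute)
  have YZ: "Y * Z \<in> carrier_mat b a" using Y Z by simp
  have uminus_zero: "- 0\<^sub>m a a = (0\<^sub>m a a :: 'a mat)" by (intro eq_matI) auto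
  have GH: "G * H = 1\<^sub>m (a + b)"
    unfolding G_def H_def
    by (subst mult_four_block_mat[of _ b a _ b _ a _ _ b _ a])
      (use Y W Z WZ add_uminus_minus_mat[OF YZ YZ] minus_r_inv_mat[OF YZ] in \<open>auto simp: uminus_zero add.commute\<close>)
  have HG: "H * G = 1\<^sub>m (a + b)"
    unfolding G_def H_def
    by (subst mult_four_block_mat[of _ a b _ a _ b _ _ a _ b])
      (use Y W Z ZW assoc_mult_mat[OF Y Z W] add_uminus_minus_mat[OF Y Y] in auto)
  show "invertible_mat G"
    using G H GH HG unfolding invertible_mat_def inverts_mat_def by auto
  have YA: "Y * A \<in> carrier_mat b a" and WA: "W * A \<in> carrier_mat a a"
    and YC: "Y * C \<in> carrier_mat b b" and WC: "W * C \<in> carrier_mat a b"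
    and BC: "B * C \<in> carrier_mat a b"
    using Y W A B C by auto
  have GU: "G * four_block_mat A C (0\<^sub>m b a) D = four_block_mat (Y * A) (Y * C + D) (W * A) (W * C)"
    unfolding G_def
    by (subst mult_four_block_mat[of _ b a _ b _ a _ _ a _ b])
      (use Y W A C D YA WA YC WC in auto)
  have Gt: "transpose_mat G = four_block_mat (- (B * C)) V (1\<^sub>m b) (0\<^sub>m b a)"
    unfolding G_def by (subst transpose_four_block_mat) (use Y W Yt Wt in auto)
  \<comment> \<open>Both are instances of \<open>A * (B * C) = C\<close>.\<close>
  have "Y * A * - (B * C) = - (Y * C)" "W * A * - (B * C) = - (W * C)"
    using assoc_mult_mat[OF Y A BC] assoc_mult_mat[OF W A BC] cancel[OF AB A B C]
      carrier_matD[OF A] carrier_matD[OF B] by simp_all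
  moreover have "- (Y * C) + (Y * C + D) = D"
    using assoc_add_mat[of "- (Y * C)" b b "Y * C" D] uminus_l_inv_mat[OF YC] YC D by simp
  ultimately have e1: "Y * A * - (B * C) + (Y * C + D) * 1\<^sub>m b = D"
    and e3: "W * A * - (B * C) + W * C * 1\<^sub>m b = 0\<^sub>m a b"
    using uminus_l_inv_mat[OF WC] right_mult_one_mat[OF WC] right_mult_one_mat[of "Y * C + D" b b]
      YC D by simp_all
  \<comment> \<open>The collapses behind the right-hand column: \<open>Y * A * V\<close> reduces to
    \<open>Y * At\<close>, and \<open>W * A * V\<close> to \<open>W * At\<close>.\<close>
  have "A * V = At"
    using cancel[OF AB A B At] by (simp add: V_def)
  moreover have "W * At = A"
    using assoc_mult_mat[OF A Bt At] BtAt A by (simp add: W_def)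
  moreover have "Y * At = - Ct"
    using assoc_mult_mat[OF Ct Bt At] BtAt Ct Bt At by (simp add: Y_def)
  ultimately have e2: "Y * A * V + (Y * C + D) * 0\<^sub>m b a = - Ct"
    and e4: "W * A * V + W * C * 0\<^sub>m b a = A"
    using assoc_mult_mat[OF Y A V] assoc_mult_mat[OF W A V] right_mult_zero_mat[OF WC, of a] A Ct YC D
    by auto
  show "four_block_mat D (- transpose_mat C) (0\<^sub>m a b) A
      = G * four_block_mat A C (0\<^sub>m b a) D * transpose_mat G"
    unfolding GU Gt
      mult_four_block_mat[OF YA add_carrier_mat[OF D] WA WC uminus_carrier_mat[OF BC] V
        one_carrier_mat zero_carrier_mat]
      e1 e2 e3 e4 Ct_def ..
qed

text \<open>Above the diagonal, an entry depends only on its two vertices, taken in order.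
  Exchanging \<open>xs\<close> and \<open>ys\<close> keeps the order inside each list, hence the
  diagonal blocks, and reverses every mixed pair; skew-symmetry turns \<open>C\<close> into its
  negative transpose.\<close>

lemma (in quiver) unipotent_companion_append:
  fixes xs ys :: "'a list"
  defines "C \<equiv> mat (length xs) (length ys) (\<lambda>(i, j). - exchange_matrix Q (xs @ ys) $$ (i, length xs + j))"
  shows "unipotent_companion Q (xs @ ys) = four_block_mat (unipotent_companion Q xs) C
      (0\<^sub>m (length ys) (length xs)) (unipotent_companion Q ys)"
    and "unipotent_companion Q (ys @ xs) = four_block_mat (unipotent_companion Q ys)
      (- transpose_mat C) (0\<^sub>m (length xs) (length ys)) (unipotent_companion Q xs)"
proof -
  show "unipotent_companion Q (xs @ ys) = four_block_mat (unipotent_companion Q xs) C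
      (0\<^sub>m (length ys) (length xs)) (unipotent_companion Q ys)"
    by (rule eq_matI) (auto simp: C_def unipotent_companion_def exchange_matrix_def nth_append)
  \<comment> \<open>Mixed pairs: in \<open>xs @ ys\<close> the vertex at j moves to the front, at j
    - \<open>length ys\<close>, and the one at i moves behind \<open>xs\<close>. The sign is where
    the absence of 2-cycles enters, through \<open>exchange_matrix_skew\<close>.\<close>
  have "exchange_matrix Q (ys @ xs) $$ (i, j) = - exchange_matrix Q (xs @ ys) $$ (j - length ys, length xs + i)"
    if "i < length ys" "length ys \<le> j" "j < length ys + length xs" for i j
  proof -
    have "exchange_matrix Q (xs @ ys) $$ (j - length ys, length xs + i) = exchange_matrix Q (ys @ xs) $$ (j, i)"
      using that less_diff_conv2[of "length ys" j "length xs"]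
      by (simp add: exchange_matrix_def nth_append)
    also have "\<dots> = - exchange_matrix Q (ys @ xs) $$ (i, j)"
      using that by (intro exchange_matrix_skew) auto
    finally show ?thesis by simp
  qed
  moreover have "exchange_matrix Q (ys @ xs) $$ (i, j) = exchange_matrix Q ys $$ (i, j)"
    if "i < length ys" "j < length ys" for i j
    using that by (simp add: exchange_matrix_def nth_append)
  moreover have "exchange_matrix Q (ys @ xs) $$ (i, j) = exchange_matrix Q xs $$ (i - length ys, j - length ys)"
    if "i < length ys + length xs" "j < length ys + length xs" "length ys \<le> i" "length ys \<le> j" for i j
    using that by (simp add: exchange_matrix_def nth_append)
  ultimately show "unipotent_companion Q (ys @ xs) = four_block_mat (unipotent_companion Q ys)
      (- transpose_mat C) (0\<^sub>m (length xs) (length ys)) (unipotent_companion Q xs)"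
    by (intro eq_matI) (auto simp: C_def unipotent_companion_def not_less)
qed

lemma unipotent_companion_carrier:
  "unipotent_companion Q vs \<in> carrier_mat (length vs) (length vs)"
  by (simp add: unipotent_companion_def)

text \<open>Makes the first diagonal block invertible over the integers, not merely over the
  rationals.\<close>

lemma det_unipotent_companion: "det (unipotent_companion Q vs) = 1"
proof -
  have "upper_triangular (unipotent_companion Q vs)"
    by (auto simp: unipotent_companion_def)
  moreover have "diag_mat (unipotent_companion Q vs) = replicate (length vs) 1"
    by (auto simp: diag_mat_def unipotent_companion_def intro!: nth_equalityI)
  ultimately show ?thesis
    using det_upper_triangular[OF _ unipotent_companion_carrier, of Q vs]
    by (metis prod_list_replicate power_one)
qed

theorem proposition4p4:
  fixes Q :: "('a, 'b) pre_digraph" and n :: nat and vs vs' :: "'a list" and U U' :: "int mat"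
  assumes "quiver Q" and "card (verts Q) = n"
    and "linear_ordering Q vs" and "linear_ordering Q vs'" and "cyclic_shift vs vs'"
    and "U = unipotent_companion Q vs" and "U' = unipotent_companion Q vs'"
  shows "\<exists>G \<in> GL_int n. U' = G * U * transpose_mat G"
proof -
  interpret quiver Q by fact
  obtain xs ys where vs: "vs = xs @ ys" and vs': "vs' = ys @ xs"
    using assms(5) unfolding cyclic_shift_def by (metis append_take_drop_id)
  have n: "n = length xs + length ys"
    using assms(2,3) distinct_card[of vs] by (simp add: linear_ordering_def vs)
  let ?A = "unipotent_companion Q xs"
  note A = unipotent_companion_carrier[of Q xs]
  define C where "C = mat (length xs) (length ys)
    (\<lambda>(i, j). - exchange_matrix Q (xs @ ys) $$ (i, length xs + j))"
  have C: "C \<in> carrier_mat (length xs) (length ys)" by (simp add: C_def)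
  \<comment> \<open>The adjugate is integral, and its product with \<open>?A\<close> is the
    determinant times the identity; with determinant 1 it serves as the inverse
    \<open>B\<close>.\<close>
  have "?A * adj_mat ?A = 1\<^sub>m (length xs)" "adj_mat ?A * ?A = 1\<^sub>m (length xs)"
    using adj_mat(2,3)[OF A] by (auto simp: det_unipotent_companion intro!: eq_matI)
  from congruent_block_swap[OF A adj_mat(1)[OF A] C unipotent_companion_carrier this]
  obtain G where G: "G \<in> carrier_mat n n" "invertible_mat G"
    and eq: "four_block_mat (unipotent_companion Q ys) (- transpose_mat C)
        (0\<^sub>m (length xs) (length ys)) ?A
      = G * four_block_mat ?A C (0\<^sub>m (length ys) (length xs)) (unipotent_companion Q ys)
        * transpose_mat G"
    unfolding n by metis
  have "U' = G * U * transpose_mat G"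
    using eq unfolding assms(6,7) vs vs' unipotent_companion_append[where xs = xs and ys = ys] C_def .
  with G show ?thesis by (auto simp: GL_int_def)
qed

end
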